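(* Let $\star\in\{\mathsf T,\mathsf H\}$ and consider the system $$(\mathrm{I})\quad\left\{\begin{array}{ll} A_kX_k^{s_k}B_k-C_kX_{k+1}^{t_k}D_k=E_k, & k=1,\dots,r-1,\\ A_rX_r^{s_r}B_r-C_rX_1^{t_r}D_r=E_r,\end{array}\right.$$ where $A_k,B_k,C_k,D_k,E_k\in\mathbb{C}^{n\times n}$, the unknowns $X_1,\dots,X_r$ are in $\mathbb{C}^{n\times n}$, and $s_k,t_k\in\{1,\star\}$ for $k=1,\dots,r$. Then there exist a system of the type $$(\mathrm{II})\quad\left\{\begin{array}{ll} \widetilde A_kY_k\widetilde B_k-\widetilde C_kY_{k+1}\widetilde D_k=\widetilde E_k, & k=1,\dots,r-1,\\ \widetilde A_rY_r\widetilde B_r-\widetilde C_rY_1^{s}\widetilde D_r=\widetilde E_r,\end{array}\right.$$ with coefficients and right-hand sides in $\mathbb{C}^{n\times n}$ and $s\in\{1,\star\}$, and symbols $u_k\in\{1,\star\}$ for $k=1,\dots,r$, such that $Y_1,\dots,Y_r$ is a solution of (II) if and only if $X_1,\dots,X_r$, with $X_k=Y_k^{u_k}$, is a solution of (I). Moreover, $s=1$ if the number of $\star$ symbols appearing among the $s_i,t_i$, $i=1,\dots,r$, in the original system (I) is even, and $s=\star$ if it is odd.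
   Context: $\mathsf T$ denotes transpose and $\mathsf H$ conjugate transpose. For a matrix $X$, $X^{1}=X$, and $X^\star$ is the transpose or the conjugate transpose according to the fixed choice of $\star$. *)

theory Defs
  imports "HOL-Analysis.Analysis"
begin

datatype star_kind = Transpose | ConjTranspose

datatype symb = One | Star

definition conj_transpose :: "complex^'n^'m \<Rightarrow> complex^'m^'n" where
  "conj_transpose X = (\<chi> i j. cnj (X $ j $ i))"

fun star :: "star_kind \<Rightarrow> complex^'n^'n \<Rightarrow> complex^'n^'n" where
  "star Transpose X = transpose X"
| "star ConjTranspose X = conj_transpose X"

fun app_symb :: "star_kind \<Rightarrow> complex^'n^'n \<Rightarrow> symb \<Rightarrow> complex^'n^'n" where
  "app_symb \<sigma> X One = X"
| "app_symb \<sigma> X Star = star \<sigma> X"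

text \<open>Coefficients, unknowns and symbols are indexed by the natural numbers; only the
  values at the indices 1, ..., r enter the systems.\<close>

definition solves_I ::
  "star_kind \<Rightarrow> nat \<Rightarrow> (nat \<Rightarrow> symb) \<Rightarrow> (nat \<Rightarrow> symb) \<Rightarrow>
   (nat \<Rightarrow> complex^'n^'n) \<Rightarrow> (nat \<Rightarrow> complex^'n^'n) \<Rightarrow> (nat \<Rightarrow> complex^'n^'n) \<Rightarrow>
   (nat \<Rightarrow> complex^'n^'n) \<Rightarrow> (nat \<Rightarrow> complex^'n^'n) \<Rightarrow> (nat \<Rightarrow> complex^'n^'n) \<Rightarrow> bool" where
  "solves_I \<sigma> r s t A B C D E X \<longleftrightarrow>
     (\<forall>k\<in>{1..<r}. A k ** app_symb \<sigma> (X k) (s k) ** B k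
                  - C k ** app_symb \<sigma> (X (k + 1)) (t k) ** D k = E k) \<and>
     A r ** app_symb \<sigma> (X r) (s r) ** B r
       - C r ** app_symb \<sigma> (X 1) (t r) ** D r = E r"

definition solves_II ::
  "star_kind \<Rightarrow> nat \<Rightarrow> symb \<Rightarrow>
   (nat \<Rightarrow> complex^'n^'n) \<Rightarrow> (nat \<Rightarrow> complex^'n^'n) \<Rightarrow> (nat \<Rightarrow> complex^'n^'n) \<Rightarrow>
   (nat \<Rightarrow> complex^'n^'n) \<Rightarrow> (nat \<Rightarrow> complex^'n^'n) \<Rightarrow> (nat \<Rightarrow> complex^'n^'n) \<Rightarrow> bool" where
  "solves_II \<sigma> r s A B C D E Y \<longleftrightarrow>
     (\<forall>k\<in>{1..<r}. A k ** Y k ** B k - C k ** Y (k + 1) ** D k = E k) \<and>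
     A r ** Y r ** B r - C r ** app_symb \<sigma> (Y 1) s ** D r = E r"

definition num_stars :: "nat \<Rightarrow> (nat \<Rightarrow> symb) \<Rightarrow> (nat \<Rightarrow> symb) \<Rightarrow> nat" where
  "num_stars r s t = card {i\<in>{1..r}. s i = Star} + card {i\<in>{1..r}. t i = Star}"

end

theory Submission
  imports Defs
begin

text \<open>The symbols \<open>1\<close> and \<open>\<star>\<close> form a group of order two that acts on square matrices, since
  \<open>\<star>\<close> is an involution. As \<open>\<star>\<close> is additive and reverses products, applying it to both sides of
  an equation \<open>A Z B - C W D = E\<close> gives an equivalent equation of the same shape, in which
  both unknowns carry an additional \<open>\<star>\<close>.

  After the substitution \<open>X\<^sub>k = Y\<^sub>k\<^bsup>u\<^sub>k\<^esup>\<close>, the unknowns of equation \<open>k\<close> carry the symbols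
  \<open>u\<^sub>k s\<^sub>k\<close> and \<open>u\<^sub>k\<^sub>+\<^sub>1 t\<^sub>k\<close>. Acting on this equation by \<open>u\<^sub>k s\<^sub>k\<close> frees \<open>Y\<^sub>k\<close> of its symbol and
  leaves \<open>u\<^sub>k s\<^sub>k t\<^sub>k u\<^sub>k\<^sub>+\<^sub>1\<close> on \<open>Y\<^sub>k\<^sub>+\<^sub>1\<close>. This symbol is trivial exactly if
  \<open>u\<^sub>k\<^sub>+\<^sub>1 = u\<^sub>k s\<^sub>k t\<^sub>k\<close>, so starting from \<open>u\<^sub>1 = 1\<close> the symbol \<open>u\<^sub>k\<close> must be the parity of the
  number of stars in the equations before \<open>k\<close> (\<open>parity_symb_num_stars\<close>).
  The last equation returns to \<open>Y\<^sub>1\<close>, where \<open>u\<^sub>1 = 1\<close> is already chosen. Its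
  remaining symbol is therefore the value that the recursion would give to \<open>u\<^sub>r\<^sub>+\<^sub>1\<close>, the parity
  of the number of all stars. The equivalence holds for each equation separately
  (\<open>equation_app_symb\<close>).\<close>

definition symb_mult :: "symb \<Rightarrow> symb \<Rightarrow> symb" where
  "symb_mult a b = (if a = b then One else Star)"

definition parity_symb :: "nat \<Rightarrow> symb" where
  "parity_symb m = (if even m then One else Star)"

lemma star_star: "star \<sigma> (star \<sigma> X) = X"
  by (cases \<sigma>) (simp_all add: transpose_def conj_transpose_def vec_eq_iff)

lemma star_mult: "star \<sigma> (X ** Y) = star \<sigma> Y ** star \<sigma> X"
  by (cases \<sigma>)
    (simp_all add: transpose_def conj_transpose_def matrix_matrix_mult_def vec_eq_iff
      mult.commute)

lemma star_diff: "star \<sigma> (X - Y) = star \<sigma> X - star \<sigma> Y"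
  by (cases \<sigma>) (simp_all add: transpose_def conj_transpose_def vec_eq_iff)

lemma app_symb_app_symb: "app_symb \<sigma> (app_symb \<sigma> X a) b = app_symb \<sigma> X (symb_mult a b)"
  by (cases a; cases b) (simp_all add: symb_mult_def star_star)

lemma app_symb_eq_iff: "app_symb \<sigma> X e = app_symb \<sigma> Y e \<longleftrightarrow> X = Y"
  by (cases e) (auto dest: arg_cong[where f = "star \<sigma>"] simp: star_star)

text \<open>Since \<open>\<star>\<close> reverses products, it moves the right coefficient to the left. The right
  coefficient of the transformed product is obtained by exchanging the last two arguments.\<close>

definition left_coeff ::
  "star_kind \<Rightarrow> symb \<Rightarrow> complex^'n^'n \<Rightarrow> complex^'n^'n \<Rightarrow> complex^'n^'n" where
  "left_coeff \<sigma> e A B = app_symb \<sigma> (if e = One then A else B) e"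

lemma app_symb_mult3:
  "app_symb \<sigma> (A ** Z ** B) e = left_coeff \<sigma> e A B ** app_symb \<sigma> Z e ** left_coeff \<sigma> e B A"
  by (cases e) (simp_all add: left_coeff_def star_mult matrix_mul_assoc)

lemma app_symb_diff: "app_symb \<sigma> (X - Y) e = app_symb \<sigma> X e - app_symb \<sigma> Y e"
  by (cases e) (simp_all add: star_diff)

lemma equation_app_symb:
  "A ** Z ** B - C ** W ** D = E \<longleftrightarrow>
     left_coeff \<sigma> e A B ** app_symb \<sigma> Z e ** left_coeff \<sigma> e B A
     - left_coeff \<sigma> e C D ** app_symb \<sigma> W e ** left_coeff \<sigma> e D C = app_symb \<sigma> E e"
  by (metis app_symb_eq_iff app_symb_diff app_symb_mult3)

text \<open>This is the recursion \<open>u\<^sub>k\<^sub>+\<^sub>1 = u\<^sub>k s\<^sub>k t\<^sub>k\<close>. Its index is shifted because \<open>u\<^sub>k\<close> counts only the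
  stars of the equations strictly before \<open>k\<close>.\<close>

lemma parity_symb_num_stars:
  assumes "k \<ge> 1"
  shows "parity_symb (num_stars k s t)
       = symb_mult (symb_mult (parity_symb (num_stars (k - 1) s t)) (s k)) (t k)"
proof -
  obtain j where k: "k = Suc j"
    using assms by (cases k) auto
  have count: "card {i \<in> {1..Suc j}. f i = Star}
      = card {i \<in> {1..j}. f i = Star} + (if f (Suc j) = Star then 1 else 0)"
    for f :: "nat \<Rightarrow> symb"
  proof -
    have "{i \<in> {1..Suc j}. f i = Star}
        = (if f (Suc j) = Star then insert (Suc j) {i \<in> {1..j}. f i = Star}
           else {i \<in> {1..j}. f i = Star})"
      by (auto simp: le_Suc_eq)
    then show ?thesis
      by simp
  qed
  show ?thesis
    unfolding k num_stars_def count
    by (cases "s (Suc j)"; cases "t (Suc j)") (simp_all add: parity_symb_def symb_mult_def)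
qed

theorem lemma14:
  fixes \<sigma> :: star_kind
    and r :: nat
    and A B C D E :: "nat \<Rightarrow> complex^'n^'n"
    and s t :: "nat \<Rightarrow> symb"
  assumes "r \<ge> 1"
  shows "\<exists>(A' :: nat \<Rightarrow> complex^'n^'n) (B' :: nat \<Rightarrow> complex^'n^'n)
          (C' :: nat \<Rightarrow> complex^'n^'n) (D' :: nat \<Rightarrow> complex^'n^'n)
          (E' :: nat \<Rightarrow> complex^'n^'n) (s' :: symb) (u :: nat \<Rightarrow> symb).
           (\<forall>Y :: nat \<Rightarrow> complex^'n^'n.
              solves_II \<sigma> r s' A' B' C' D' E' Y \<longleftrightarrow>
              solves_I \<sigma> r s t A B C D E (\<lambda>k. app_symb \<sigma> (Y k) (u k))) \<and>
           (even (num_stars r s t) \<longrightarrow> s' = One) \<and>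
           (odd (num_stars r s t) \<longrightarrow> s' = Star)"
proof -
  define u where "u k = parity_symb (num_stars (k - 1) s t)" for k
  \<comment> \<open>the symbol on \<open>Y\<^sub>k\<close> in equation \<open>k\<close> after the substitution; acting by it frees \<open>Y\<^sub>k\<close>\<close>
  define e where "e k = symb_mult (u k) (s k)" for k
  define s' where "s' = parity_symb (num_stars r s t)"
  have u_1: "u 1 = One"
    by (simp add: u_def num_stars_def parity_symb_def)
  have u_Suc: "u (k + 1) = symb_mult (e k) (t k)" if "k \<ge> 1" for k
    using parity_symb_num_stars[OF that] by (simp add: u_def e_def)
  have s'_eq: "s' = symb_mult (e r) (t r)"
    using u_Suc[OF assms] by (simp add: u_def s'_def)
  have current: "app_symb \<sigma> (app_symb \<sigma> (app_symb \<sigma> Z (u k)) (s k)) (e k) = Z"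
    for k and Z :: "complex^'n^'n"
    by (simp add: app_symb_app_symb e_def) (simp add: symb_mult_def)
  have following: "app_symb \<sigma> (app_symb \<sigma> (app_symb \<sigma> Z (u (k + 1))) (t k)) (e k) = Z"
    if "k \<ge> 1" for k and Z :: "complex^'n^'n"
    unfolding app_symb_app_symb u_Suc[OF that]
    by (cases "e k"; cases "t k") (simp_all add: symb_mult_def)
  have closing: "app_symb \<sigma> (app_symb \<sigma> (app_symb \<sigma> Z (u 1)) (t r)) (e r) = app_symb \<sigma> Z s'"
    for Z :: "complex^'n^'n"
    unfolding app_symb_app_symb u_1 s'_eq
    by (cases "e r"; cases "t r") (simp_all add: symb_mult_def)
  let ?A = "\<lambda>k. left_coeff \<sigma> (e k) (A k) (B k)" and ?B = "\<lambda>k. left_coeff \<sigma> (e k) (B k) (A k)"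
    and ?C = "\<lambda>k. left_coeff \<sigma> (e k) (C k) (D k)" and ?D = "\<lambda>k. left_coeff \<sigma> (e k) (D k) (C k)"
    and ?E = "\<lambda>k. app_symb \<sigma> (E k) (e k)"
  have "solves_II \<sigma> r s' ?A ?B ?C ?D ?E Y \<longleftrightarrow>
      solves_I \<sigma> r s t A B C D E (\<lambda>k. app_symb \<sigma> (Y k) (u k))" for Y :: "nat \<Rightarrow> complex^'n^'n"
  proof -
    have inner: "A k ** app_symb \<sigma> (app_symb \<sigma> (Y k) (u k)) (s k) ** B k
          - C k ** app_symb \<sigma> (app_symb \<sigma> (Y (k + 1)) (u (k + 1))) (t k) ** D k = E k \<longleftrightarrow>
        ?A k ** Y k ** ?B k - ?C k ** Y (k + 1) ** ?D k = ?E k" if "k \<in> {1..<r}" for k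
    proof -
      have "k \<ge> 1" using that by simp
      show ?thesis
        by (subst equation_app_symb[where \<sigma> = \<sigma> and e = "e k"])
          (simp only: current following[OF \<open>k \<ge> 1\<close>])
    qed
    have last: "A r ** app_symb \<sigma> (app_symb \<sigma> (Y r) (u r)) (s r) ** B r
          - C r ** app_symb \<sigma> (app_symb \<sigma> (Y 1) (u 1)) (t r) ** D r = E r \<longleftrightarrow>
        ?A r ** Y r ** ?B r - ?C r ** app_symb \<sigma> (Y 1) s' ** ?D r = ?E r"
      by (subst equation_app_symb[where \<sigma> = \<sigma> and e = "e r"]) (simp only: current closing)
    show ?thesis
      unfolding solves_I_def solves_II_def last using inner by blast
  qed
  moreover have "even (num_stars r s t) \<longrightarrow> s' = One" "odd (num_stars r s t) \<longrightarrow> s' = Star"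
    by (simp_all add: s'_def parity_symb_def)
  ultimately show ?thesis
    by blast
qed

end
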